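(* Let $\mathcal T\subset\mathbb{R}^3$ be a nondegenerate tetrahedron of volume $V$ with vertices $\boldsymbol p_1,\dots,\boldsymbol p_4$, let $\overline{\boldsymbol\sigma}$ be a constant symmetric $3\times3$ matrix (the conductivity tensor on the element), and let $\varphi_1,\dots,\varphi_4$ be the first order (affine) basis functions on $\mathcal T$ with $\varphi_i(\boldsymbol p_j)=\delta_{ij}$. Then the element stiffness matrix $\boldsymbol K^e\in\mathbb{R}^{4\times4}$ with entries $$K^e_{ij}=\int_{\mathcal T}\langle\overline{\boldsymbol\sigma}\nabla\varphi_i(\boldsymbol r),\nabla\varphi_j(\boldsymbol r)\rangle\,d\boldsymbol r$$ is given by $$\boldsymbol K^e=\frac{1}{36V}\,\boldsymbol\Lambda^T\,\overline{\boldsymbol\sigma}\,\boldsymbol\Lambda .$$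
   Context: $\boldsymbol\Lambda$ is the $3\times4$ matrix whose $i$-th column is $[b_i,c_i,d_i]^T$, where $a_i,b_i,c_i,d_i\in\mathbb{R}$ (depending on the vertices) are the coefficients of the volume coordinates of $\mathcal T$: for $\boldsymbol r=[x_1,x_2,x_3]^T\in\mathcal T$, $\xi_i=V_i/V=(a_i+b_ix_1+c_ix_2+d_ix_3)/(6V)$, with $V_i$ the volume of the tetrahedron with vertices $\boldsymbol r$ and $\boldsymbol p_j$, $j\ne i$. For first order basis functions $\varphi_i=\xi_i$. *)

theory Defs
  imports "HOL-Analysis.Analysis"
begin

definition nondegenerate_tetrahedron :: "(4 \<Rightarrow> real ^ 3) \<Rightarrow> bool" where
  "nondegenerate_tetrahedron p \<longleftrightarrow> inj p \<and> \<not> affine_dependent (range p)"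

definition tetrahedron :: "(4 \<Rightarrow> real ^ 3) \<Rightarrow> (real ^ 3) set" where
  "tetrahedron p = convex hull (range p)"

definition tet_volume :: "(4 \<Rightarrow> real ^ 3) \<Rightarrow> real" where
  "tet_volume p = measure lebesgue (tetrahedron p)"

(* p(i := r) has the vertices r and p j for j \<noteq> i, so tet_volume (p(i := r)) is V_i. *)
definition volume_coord :: "(4 \<Rightarrow> real ^ 3) \<Rightarrow> 4 \<Rightarrow> real ^ 3 \<Rightarrow> real" where
  "volume_coord p i r = tet_volume (p(i := r)) / tet_volume p"

(* For a nondegenerate tetrahedron the quadruple exists and is unique: the tetrahedron
   has interior points, and an affine function is determined by its values there. *)
definition volume_coeffs :: "(4 \<Rightarrow> real ^ 3) \<Rightarrow> 4 \<Rightarrow> real \<times> real \<times> real \<times> real" where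
  "volume_coeffs p i =
     (THE (a, b, c, d). \<forall>r \<in> tetrahedron p.
        volume_coord p i r = (a + b * r $ 1 + c * r $ 2 + d * r $ 3) / (6 * tet_volume p))"

definition Lambda_mat :: "(4 \<Rightarrow> real ^ 3) \<Rightarrow> real ^ 4 ^ 3" where
  "Lambda_mat p = (\<chi> k i. case volume_coeffs p i of (a, b, c, d) \<Rightarrow> vector [b, c, d] $ k)"

definition affine_fun_on :: "(real ^ 3) set \<Rightarrow> (real ^ 3 \<Rightarrow> real) \<Rightarrow> bool" where
  "affine_fun_on S f \<longleftrightarrow> (\<exists>c v. \<forall>r \<in> S. f r = c + v \<bullet> r)"

(* Only the values on the tetrahedron are constrained, so that the globally defined,
   piecewise affine finite element functions are covered as well. *)
definition first_order_basis :: "(4 \<Rightarrow> real ^ 3) \<Rightarrow> (4 \<Rightarrow> real ^ 3 \<Rightarrow> real) \<Rightarrow> bool" where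
  "first_order_basis p \<phi> \<longleftrightarrow>
     (\<forall>i. affine_fun_on (tetrahedron p) (\<phi> i)) \<and>
     (\<forall>i j. \<phi> i (p j) = (if i = j then 1 else 0))"

(* Unspecified where f is not differentiable; for the basis functions this can only
   happen on the boundary of the tetrahedron, a null set. *)
definition gradient :: "(real ^ 3 \<Rightarrow> real) \<Rightarrow> real ^ 3 \<Rightarrow> real ^ 3" where
  "gradient f r = (THE D. GDERIV f r :> D)"

definition element_stiffness ::
    "real ^ 3 ^ 3 \<Rightarrow> (real ^ 3) set \<Rightarrow> (4 \<Rightarrow> real ^ 3 \<Rightarrow> real) \<Rightarrow> real ^ 4 ^ 4" where
  "element_stiffness \<sigma> T \<phi> =
     (\<chi> i j. integral T (\<lambda>r. (\<sigma> *v gradient (\<phi> i) r) \<bullet> gradient (\<phi> j) r))"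

end

theory Submission
  imports Defs
begin

text \<open>
  Write \<open>\<phi>\<^sub>i r = c\<^sub>i + v\<^sub>i \<bullet> r\<close> on the tetrahedron \<open>T\<close>. The core of the proof is that the volume
  coordinate \<open>V\<^sub>i / V\<close> is \<open>\<phi>\<^sub>i\<close> itself (\<open>volume_coord_eq_basis\<close>). The affine map
  \<open>x \<mapsto> x + \<phi>\<^sub>i x (r - p\<^sub>i)\<close> fixes the vertices \<open>p\<^sub>j\<close> with \<open>j \<noteq> i\<close> and moves \<open>p\<^sub>i\<close> to \<open>r\<close>, so it
  carries \<open>T\<close> onto the tetrahedron whose volume is \<open>V\<^sub>i\<close>. Its linear part is a rank-one
  perturbation of the identity, with determinant \<open>1 + v\<^sub>i \<bullet> (r - p\<^sub>i) = \<phi>\<^sub>i r\<close>, which is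
  nonnegative on \<open>T\<close>.

  Since \<open>T\<close> has interior points, an affine function on \<open>T\<close> determines its coefficients. Hence
  the \<open>i\<close>-th column of \<open>\<Lambda>\<close> is \<open>6 V v\<^sub>i\<close>. The gradient of \<open>\<phi>\<^sub>i\<close> is \<open>v\<^sub>i\<close> in the interior of \<open>T\<close>,
  that is, almost everywhere, so the integrand is almost everywhere constant and
  \<open>K\<^sub>i\<^sub>j = V \<langle>\<sigma> v\<^sub>i, v\<^sub>j\<rangle>\<close>. The factor \<open>1 / (36 V)\<close> turns the two factors \<open>6 V\<close> from \<open>\<Lambda>\<close> into
  this \<open>V\<close>, and the symmetry of \<open>\<sigma>\<close> matches the order of \<open>i\<close> and \<open>j\<close>.
\<close>

section \<open>Volume under rank-one perturbations of the identity\<close>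

lemma det_rank_one_perturbation:
  fixes u v :: "real ^ 3"
  shows "det (matrix (\<lambda>x. x + (v \<bullet> x) *\<^sub>R u)) = 1 + v \<bullet> u"
  by (simp add: matrix_def det_3 inner_axis axis_def inner_vec_def sum_3 algebra_simps)

lemma linear_rank_one_perturbation:
  fixes u v :: "'a::real_inner"
  shows "linear (\<lambda>x. x + (v \<bullet> x) *\<^sub>R u)"
  by (rule linearI) (simp_all add: inner_add_right scaleR_add_left scaleR_add_right)

lemma affine_rank_one_image:
  fixes u v :: "'a::real_inner"
  shows "(\<lambda>x. x + (c + v \<bullet> x) *\<^sub>R u) ` S = (+) (c *\<^sub>R u) ` (\<lambda>x. x + (v \<bullet> x) *\<^sub>R u) ` S"
  by (simp add: image_image algebra_simps)

lemma measure_affine_rank_one_image: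
  fixes u v :: "real ^ 3"
  assumes "S \<in> lmeasurable"
  shows "measure lebesgue ((\<lambda>x. x + (c + v \<bullet> x) *\<^sub>R u) ` S) = \<bar>1 + v \<bullet> u\<bar> * measure lebesgue S"
  by (simp add: affine_rank_one_image measure_translation assms
      measure_linear_image[OF linear_rank_one_perturbation] det_rank_one_perturbation)

lemma convex_hull_affine_rank_one_image:
  fixes u v :: "'a::real_inner"
  shows "(\<lambda>x. x + (c + v \<bullet> x) *\<^sub>R u) ` (convex hull S)
    = convex hull ((\<lambda>x. x + (c + v \<bullet> x) *\<^sub>R u) ` S)"
  by (simp add: affine_rank_one_image convex_hull_translation
      convex_hull_linear_image[OF linear_rank_one_perturbation])

section \<open>Nondegenerate tetrahedra\<close>

lemma vertex_in_tetrahedron: "p j \<in> tetrahedron p"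
  by (simp add: tetrahedron_def hull_inc)

lemma tetrahedron_lmeasurable: "tetrahedron p \<in> lmeasurable"
  by (simp add: tetrahedron_def lmeasurable_compact finite_imp_compact_convex_hull)

lemma interior_tetrahedron_nonempty:
  assumes "nondegenerate_tetrahedron p"
  shows "interior (tetrahedron p) \<noteq> {}"
proof -
  have "card (range p) = Suc (DIM(real ^ 3))"
    using assms by (simp add: nondegenerate_tetrahedron_def card_image)
  then show ?thesis
    using assms interior_convex_hull_eq_empty[of "range p"]
    by (simp add: nondegenerate_tetrahedron_def tetrahedron_def)
qed

lemma tet_volume_pos:
  assumes "nondegenerate_tetrahedron p"
  shows "tet_volume p > 0"
proof -
  have "\<not> negligible (tetrahedron p)"
    using interior_tetrahedron_nonempty[OF assms]
    by (simp add: tetrahedron_def negligible_convex_interior)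
  then have "measure lebesgue (tetrahedron p) \<noteq> 0"
    by (simp add: negligible_iff_measure0 tetrahedron_lmeasurable)
  then show ?thesis
    by (simp add: tet_volume_def zero_less_measure_iff)
qed

lemma affine_coeffs_unique:
  fixes v w :: "'a::real_inner"
  assumes "interior S \<noteq> {}" and eq: "\<And>r. r \<in> S \<Longrightarrow> c + v \<bullet> r = d + w \<bullet> r"
  shows "c = d \<and> v = w"
proof -
  obtain x e where e: "e > 0" "cball x e \<subseteq> S"
    using assms(1) by (auto simp: mem_interior_cball)
  have x: "x \<in> S"
    using e by auto
  have "v = w"
  proof (rule ccontr)
    assume "v \<noteq> w"
    define y where "y = x + (e / norm (v - w)) *\<^sub>R (v - w)"
    have "y \<in> S"
      using e \<open>v \<noteq> w\<close> by (intro subsetD[OF e(2)]) (simp add: y_def dist_norm)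
    then have "(v - w) \<bullet> (y - x) = 0"
      using eq[of y] eq[OF x] by (simp add: inner_diff_left inner_diff_right)
    then show False
      using e \<open>v \<noteq> w\<close> by (simp add: y_def)
  qed
  then show ?thesis
    using eq[OF x] by simp
qed

section \<open>Volume coordinates are the basis functions\<close>

text \<open>The point \<open>p\<^sub>i\<close> has coordinate \<open>1\<close>, so replacing it by \<open>r\<close> scales volumes by the
  determinant \<open>1 + v \<bullet> (r - p\<^sub>i)\<close>, which is the value of the affine function at \<open>r\<close>.\<close>

lemma volume_coord_eq_basis:
  assumes nd: "nondegenerate_tetrahedron p"
    and vert: "\<And>j. c + v \<bullet> p j = (if i = j then 1 else 0)"
    and r: "r \<in> tetrahedron p"
  shows "volume_coord p i r = c + v \<bullet> r"
proof -
  define A where "A = (\<lambda>x. x + (c + v \<bullet> x) *\<^sub>R (r - p i))"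
  have "A (p j) = (p(i := r)) j" for j
    by (simp add: A_def vert)
  then have "range (p(i := r)) = A ` range p"
    by (metis (no_types, lifting) image_cong image_image)
  then have "tetrahedron (p(i := r)) = A ` tetrahedron p"
    by (simp add: tetrahedron_def A_def convex_hull_affine_rank_one_image)
  then have "tet_volume (p(i := r)) = \<bar>1 + v \<bullet> (r - p i)\<bar> * tet_volume p"
    by (simp add: tet_volume_def A_def measure_affine_rank_one_image tetrahedron_lmeasurable)
  moreover have "1 + v \<bullet> (r - p i) = c + v \<bullet> r"
    using vert[of i] by (simp add: inner_diff_right)
  moreover have "c + v \<bullet> r \<ge> 0"
  proof -
    have "range p \<subseteq> {x. v \<bullet> x \<ge> - c}"
    proof clarify
      fix j
      show "v \<bullet> p j \<ge> - c"
        using vert[of j] by (simp split: if_splits)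
    qed
    then have "tetrahedron p \<subseteq> {x. v \<bullet> x \<ge> - c}"
      unfolding tetrahedron_def by (rule hull_minimal) (rule convex_halfspace_ge)
    then show ?thesis
      using r by auto
  qed
  ultimately show ?thesis
    using tet_volume_pos[OF nd] by (simp add: volume_coord_def)
qed

lemma volume_coeffs_eq:
  assumes nd: "nondegenerate_tetrahedron p"
    and vert: "\<And>j. c + v \<bullet> p j = (if i = j then 1 else 0)"
  shows "volume_coeffs p i =
    (6 * tet_volume p * c, 6 * tet_volume p * v $ 1, 6 * tet_volume p * v $ 2,
     6 * tet_volume p * v $ 3)"
proof -
  define V where "V = tet_volume p"
  have V: "V > 0"
    using tet_volume_pos[OF nd] by (simp add: V_def)
  show ?thesis
    unfolding volume_coeffs_def V_def[symmetric]
  proof (rule the_equality, goal_cases)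
    case 1
    show ?case
      using V by (simp add: volume_coord_eq_basis[OF nd vert] inner_vec_def sum_3 field_simps)
  next
    case (2 q)
    obtain a b c' d where q: "q = (a, b, c', d)"
      by (cases q)
    let ?w = "vector [b / (6 * V), c' / (6 * V), d / (6 * V)] :: real ^ 3"
    have "a / (6 * V) + ?w \<bullet> r = c + v \<bullet> r" if "r \<in> tetrahedron p" for r
    proof -
      have "a / (6 * V) + ?w \<bullet> r = (a + b * r $ 1 + c' * r $ 2 + d * r $ 3) / (6 * V)"
        by (simp add: inner_vec_def sum_3 add_divide_distrib)
      also have "\<dots> = volume_coord p i r"
        using 2 that by (simp add: q)
      also have "\<dots> = c + v \<bullet> r"
        by (rule volume_coord_eq_basis[OF nd vert that])
      finally show ?thesis .
    qed
    from affine_coeffs_unique[OF interior_tetrahedron_nonempty[OF nd] this]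
    have "a / (6 * V) = c" "?w = v"
      by auto
    then show ?case
      using V by (auto simp: q)
  qed
qed

lemma Lambda_mat_column:
  assumes "nondegenerate_tetrahedron p"
    and "\<And>j. c + v \<bullet> p j = (if i = j then 1 else 0)"
  shows "Lambda_mat p $ k $ i = 6 * tet_volume p * v $ k"
  using exhaust_3[of k] by (auto simp: Lambda_mat_def volume_coeffs_eq[OF assms])

section \<open>The stiffness integral\<close>

lemma gradient_affine:
  assumes r: "r \<in> interior S" and f: "\<And>x. x \<in> S \<Longrightarrow> f x = c + v \<bullet> x"
  shows "gradient f r = v"
proof -
  have "((\<lambda>x. c + v \<bullet> x) has_derivative (\<lambda>h. h \<bullet> v)) (at r)"
    by (auto intro!: derivative_eq_intros simp: inner_commute)
  then have D: "GDERIV f r :> v"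
    unfolding gderiv_def
    by (rule has_derivative_transform_within_open[of _ _ _ _ "interior S"])
      (use r f interior_subset[of S] in auto)
  have "w = v" if "GDERIV f r :> w" for w
  proof -
    have "(\<lambda>h. h \<bullet> w) = (\<lambda>h. h \<bullet> v)"
      using has_derivative_unique that D unfolding gderiv_def by blast
    then show ?thesis
      by (metis vector_eq_ldot)
  qed
  with D show ?thesis
    unfolding gradient_def by (blast intro: the_equality)
qed

text \<open>On the faces, where the gradients may fail to exist, the integrand is arbitrary; the faces
  form a null set because the frontier of a convex set is negligible.\<close>

lemma element_stiffness_affine:
  assumes "\<And>i r. r \<in> tetrahedron p \<Longrightarrow> \<phi> i r = c i + v i \<bullet> r"
  shows "element_stiffness \<sigma> (tetrahedron p) \<phi> $ i $ j = tet_volume p * ((\<sigma> *v v i) \<bullet> v j)"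
proof -
  let ?T = "tetrahedron p"
  have "integral ?T (\<lambda>r. (\<sigma> *v gradient (\<phi> i) r) \<bullet> gradient (\<phi> j) r)
      = integral ?T (\<lambda>r. (\<sigma> *v v i) \<bullet> v j)"
  proof (rule integral_spike)
    show "negligible (frontier ?T)"
      by (simp add: tetrahedron_def negligible_convex_frontier)
    fix r
    assume "r \<in> ?T - frontier ?T"
    then have r: "r \<in> interior ?T"
      using closure_subset by (auto simp: frontier_def)
    show "(\<sigma> *v v i) \<bullet> v j = (\<sigma> *v gradient (\<phi> i) r) \<bullet> gradient (\<phi> j) r"
      by (simp add: gradient_affine[OF r assms])
  qed
  also have "\<dots> = tet_volume p * ((\<sigma> *v v i) \<bullet> v j)"
    using Henstock_Kurzweil_Integration.integral_mult_left[of ?T "\<lambda>_. 1" "(\<sigma> *v v i) \<bullet> v j"]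
    by (simp add: tet_volume_def lmeasure_integral tetrahedron_lmeasurable)
  finally show ?thesis
    by (simp add: element_stiffness_def)
qed

theorem mainTheorem3:
  fixes p :: "4 \<Rightarrow> real ^ 3"
    and \<sigma> :: "real ^ 3 ^ 3"
    and \<phi> :: "4 \<Rightarrow> real ^ 3 \<Rightarrow> real"
  assumes "nondegenerate_tetrahedron p"
    and "transpose \<sigma> = \<sigma>"
    and "first_order_basis p \<phi>"
  shows "element_stiffness \<sigma> (tetrahedron p) \<phi> =
    (1 / (36 * tet_volume p)) *\<^sub>R (transpose (Lambda_mat p) ** \<sigma> ** Lambda_mat p)"
proof -
  obtain c v where aff: "\<And>i r. r \<in> tetrahedron p \<Longrightarrow> \<phi> i r = c i + v i \<bullet> r"
    using assms(3) unfolding first_order_basis_def affine_fun_on_def by metis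
  have vert: "c i + v i \<bullet> p j = (if i = j then 1 else 0)" for i j
    using assms(3) aff[OF vertex_in_tetrahedron] by (simp add: first_order_basis_def)
  define V where "V = tet_volume p"
  have V: "V > 0"
    using tet_volume_pos[OF assms(1)] by (simp add: V_def)
  have sym: "\<sigma> $ k $ l = \<sigma> $ l $ k" for k l
    using arg_cong[OF assms(2), of "\<lambda>M. M $ l $ k"] by (simp add: transpose_def)
  have "(transpose (Lambda_mat p) ** \<sigma> ** Lambda_mat p) $ i $ j
      = 36 * V\<^sup>2 * ((\<sigma> *v v i) \<bullet> v j)" for i j
    using sym[of 2 1] sym[of 3 1] sym[of 3 2]
    by (simp add: matrix_matrix_mult_def transpose_def matrix_vector_mult_def inner_vec_def sum_3
        Lambda_mat_column[OF assms(1) vert] V_def[symmetric] power2_eq_square algebra_simps)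
  then show ?thesis
    using V by (simp add: vec_eq_iff element_stiffness_affine[of p \<phi>, OF aff] V_def[symmetric]
        power2_eq_square)
qed

end
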